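(* Let $\mathfrak{A}$ be a $C^*$-algebra and let $H,K$ be Hilbert $\mathfrak{A}$-modules. Let $T\in\mathcal{L}(H,K)$ be such that $\overline{\mathcal{R}(T^* )}$ is orthogonally complemented. Let $U\in\mathcal{L}(H,K)$ be a partial isometry which satisfies $$T=U|T|\quad\text{and}\quad \mathcal{N}(T)\subseteq\mathcal{N}(U).$$ Then $T=U|T|$ is the polar decomposition of $T$.
   Context: $\mathcal{L}(H,K)$ denotes the set of adjointable operators from $H$ to $K$, i.e. maps $T:H\to K$ for which there is $T^*:K\to H$ with $\langle Tx,y\rangle=\langle x,T^*y\rangle$ for all $x\in H$, $y\in K$. $\mathcal{R}(T)$ and $\mathcal{N}(T)$ are the range and null space of $T$; the bar denotes norm closure. A closed submodule $M$ of a Hilbert $\mathfrak{A}$-module $E$ is orthogonally complemented if $E=M\dotplus M^\perp$, where $M^\perp=\{x\in E:\langle x,y\rangle=0 \text{ for all } y\in M\}$; in that case $P_M$ denotes the projection from $E$ onto $M$ along $M^\perp$. An operator $U\in\mathcal{L}(H,K)$ is a partial isometry if $U^*U$ is a projection in $\mathcal{L}(H)$. $|T|=(T^*T)^{1/2}$. "$T=U|T|$ is the polar decomposition of $T$" means: $U\in\mathcal{L}(H,K)$ is a partial isometry, $T=U|T|$, $\overline{\mathcal{R}(T^* )}$ is orthogonally complemented, and $U^*U=P_{\overline{\mathcal{R}(T^* )}}$. *)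

theory Defs
  imports "HOL-Analysis.Analysis"
begin

class complex_vector = real_vector +
  fixes scaleC :: "complex \<Rightarrow> 'a \<Rightarrow> 'a" (infixr "*\<^sub>C" 75)
  assumes scaleC_add_right: "c *\<^sub>C (x + y) = c *\<^sub>C x + c *\<^sub>C y"
    and scaleC_add_left: "(c + d) *\<^sub>C x = c *\<^sub>C x + d *\<^sub>C x"
    and scaleC_scaleC: "c *\<^sub>C (d *\<^sub>C x) = (c * d) *\<^sub>C x"
    and scaleC_one: "1 *\<^sub>C x = x"
    and scaleR_scaleC: "r *\<^sub>R x = complex_of_real r *\<^sub>C x"

class complex_normed_vector = complex_vector + real_normed_vector +
  assumes norm_scaleC: "norm (c *\<^sub>C x) = cmod c * norm x"

class complex_banach = complex_normed_vector + complete_space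

text \<open>C*-algebras, not assumed to be unital.\<close>

class cstar_algebra = complex_banach + real_normed_algebra +
  fixes star :: "'a \<Rightarrow> 'a"
  assumes scaleC_mult_left: "(c *\<^sub>C x) * y = c *\<^sub>C (x * y)"
    and scaleC_mult_right: "x * (c *\<^sub>C y) = c *\<^sub>C (x * y)"
    and star_add: "star (x + y) = star x + star y"
    and star_scaleC: "star (c *\<^sub>C x) = cnj c *\<^sub>C star x"
    and star_mult: "star (x * y) = star y * star x"
    and star_star: "star (star x) = x"
    and cstar_identity: "norm (star x * x) = (norm x)\<^sup>2"

definition positive_element :: "'a::cstar_algebra \<Rightarrow> bool" where
  "positive_element a \<longleftrightarrow> (\<exists>b. a = star b * b)"

text \<open>
  A Hilbert C*-module is a type of class \<^class>\<open>complex_banach\<close> together with a right action of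
  the algebra and an algebra-valued inner product that is linear in its second argument. The last
  axiom says that the norm of the type is the one induced by the inner product, so that
  completeness and norm closures are the ones provided by the type.
\<close>

locale hilbert_module =
  fixes act :: "'h::complex_banach \<Rightarrow> 'a::cstar_algebra \<Rightarrow> 'h"
    and ip :: "'h \<Rightarrow> 'h \<Rightarrow> 'a"
  assumes act_add_left: "act (x + y) a = act x a + act y a"
    and act_add_right: "act x (a + b) = act x a + act x b"
    and act_act: "act (act x a) b = act x (a * b)"
    and act_scaleC_left: "act (c *\<^sub>C x) a = c *\<^sub>C act x a"
    and act_scaleC_right: "act x (c *\<^sub>C a) = c *\<^sub>C act x a"
    and ip_add_right: "ip x (y + z) = ip x y + ip x z"
    and ip_scaleC_right: "ip x (c *\<^sub>C y) = c *\<^sub>C ip x y"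
    and ip_act_right: "ip x (act y a) = ip x y * a"
    and ip_star: "star (ip x y) = ip y x"
    and ip_positive: "positive_element (ip x x)"
    and ip_definite: "ip x x = 0 \<Longrightarrow> x = 0"
    and norm_eq_sqrt_ip: "norm x = sqrt (norm (ip x x))"

text \<open>
  In the following, \<open>ip\<close>, \<open>ipH\<close>, \<open>ipK\<close> are the inner products of the Hilbert modules concerned.
\<close>

definition adjointable ::
    "('h \<Rightarrow> 'h \<Rightarrow> 'a) \<Rightarrow> ('k \<Rightarrow> 'k \<Rightarrow> 'a) \<Rightarrow> ('h \<Rightarrow> 'k) set" where
  "adjointable ipH ipK = {T. \<exists>S. \<forall>x y. ipK (T x) y = ipH x (S y)}"

definition adj ::
    "('h \<Rightarrow> 'h \<Rightarrow> 'a) \<Rightarrow> ('k \<Rightarrow> 'k \<Rightarrow> 'a) \<Rightarrow> ('h \<Rightarrow> 'k) \<Rightarrow> 'k \<Rightarrow> 'h" where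
  "adj ipH ipK T = (THE S. \<forall>x y. ipK (T x) y = ipH x (S y))"

definition null_space :: "('h \<Rightarrow> 'k::zero) \<Rightarrow> 'h set" where
  "null_space T = {x. T x = 0}"

definition orth_compl :: "('h \<Rightarrow> 'h \<Rightarrow> 'a::zero) \<Rightarrow> 'h set \<Rightarrow> 'h set" where
  "orth_compl ip M = {x. \<forall>y\<in>M. ip x y = 0}"

definition orthogonally_complemented ::
    "('h::ab_group_add \<Rightarrow> 'h \<Rightarrow> 'a::zero) \<Rightarrow> 'h set \<Rightarrow> bool" where
  "orthogonally_complemented ip M \<longleftrightarrow>
     {m + n | m n. m \<in> M \<and> n \<in> orth_compl ip M} = UNIV \<and> M \<inter> orth_compl ip M = {0}"

definition proj_onto ::
    "('h::ab_group_add \<Rightarrow> 'h \<Rightarrow> 'a::zero) \<Rightarrow> 'h set \<Rightarrow> 'h \<Rightarrow> 'h" where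
  "proj_onto ip M x = (THE m. m \<in> M \<and> x - m \<in> orth_compl ip M)"

definition projection :: "('h \<Rightarrow> 'h \<Rightarrow> 'a) \<Rightarrow> ('h \<Rightarrow> 'h) \<Rightarrow> bool" where
  "projection ip P \<longleftrightarrow> P \<in> adjointable ip ip \<and> adj ip ip P = P \<and> P \<circ> P = P"

definition partial_isometry ::
    "('h \<Rightarrow> 'h \<Rightarrow> 'a) \<Rightarrow> ('k \<Rightarrow> 'k \<Rightarrow> 'a) \<Rightarrow> ('h \<Rightarrow> 'k) \<Rightarrow> bool" where
  "partial_isometry ipH ipK U \<longleftrightarrow>
     U \<in> adjointable ipH ipK \<and> projection ipH (adj ipH ipK U \<circ> U)"

text \<open>Positivity in the C*-algebra of adjointable operators on one module.\<close>

definition positive_operator :: "('h \<Rightarrow> 'h \<Rightarrow> 'a) \<Rightarrow> ('h \<Rightarrow> 'h) \<Rightarrow> bool" where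
  "positive_operator ip S \<longleftrightarrow> (\<exists>R\<in>adjointable ip ip. S = adj ip ip R \<circ> R)"

definition sqrt_operator :: "('h \<Rightarrow> 'h \<Rightarrow> 'a) \<Rightarrow> ('h \<Rightarrow> 'h) \<Rightarrow> 'h \<Rightarrow> 'h" where
  "sqrt_operator ip B = (THE S. positive_operator ip S \<and> S \<circ> S = B)"

definition abs_operator ::
    "('h \<Rightarrow> 'h \<Rightarrow> 'a) \<Rightarrow> ('k \<Rightarrow> 'k \<Rightarrow> 'a) \<Rightarrow> ('h \<Rightarrow> 'k) \<Rightarrow> 'h \<Rightarrow> 'h" where
  "abs_operator ipH ipK T = sqrt_operator ipH (adj ipH ipK T \<circ> T)"

definition is_polar_decomposition ::
    "('h::complex_banach \<Rightarrow> 'h \<Rightarrow> 'a::cstar_algebra) \<Rightarrow> ('k::complex_banach \<Rightarrow> 'k \<Rightarrow> 'a)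
      \<Rightarrow> ('h \<Rightarrow> 'k) \<Rightarrow> ('h \<Rightarrow> 'k) \<Rightarrow> bool" where
  "is_polar_decomposition ipH ipK T U \<longleftrightarrow>
     partial_isometry ipH ipK U \<and>
     T = U \<circ> abs_operator ipH ipK T \<and>
     orthogonally_complemented ipH (closure (range (adj ipH ipK T))) \<and>
     adj ipH ipK U \<circ> U = proj_onto ipH (closure (range (adj ipH ipK T)))"

end

theory Submission
  imports Defs
begin

text \<open>
  Once \<open>|T|\<close> is known to be symmetric with \<open>|T|\<^sup>2 = T\<^sup>*T\<close>, the theorem is short: with \<open>Q = U\<^sup>*U\<close>,
  the identity \<open>|T| Q |T| = T\<^sup>*T = |T|\<^sup>2\<close> forces \<open>Q |T| = |T|\<close>, so \<open>Q\<close> is the identity on the closure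
  of the range of \<open>T\<^sup>* = |T| U\<^sup>*\<close>, and \<open>Q\<close> vanishes on its orthogonal complement \<open>N(T) \<subseteq> N(U)\<close>.

  The substance is therefore the existence and uniqueness of the positive square root of \<open>T\<^sup>*T\<close>. It is
  obtained without spectral theory. Call a symmetric \<open>h\<close> positive if \<open>\<parallel>t - h\<parallel> \<le> t\<close> for some \<open>t > 0\<close>;
  such elements form a cone and have square roots by a convergent iteration. If \<open>k, l\<close> commute
  and \<open>k\<^sup>2 + l\<^sup>2 = t\<close>, then \<open>k \<plusminus> \<i>l\<close> are multiples of isometries, hence \<open>\<parallel>k\<parallel>\<^sup>2 \<le> t\<close>; this shows that
  squares are positive and that the cone is proper. Kaplansky's argument then gives positivity of \<open>x\<^sup>*x\<close>.
  It is applied first to the algebra acting on itself by left multiplication, which yields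
  the order on the algebra and the Cauchy--Schwarz inequality in every Hilbert module, and then to the
  operators on \<open>H\<close>, which are bounded by Baire's theorem.
\<close>

section \<open>The Banach algebra of bounded operators\<close>

subclass (in complex_banach) banach ..

text \<open>
  A copy of the bounded linear maps with composition as multiplication. On the trivial space
  \<open>1 = 0\<close>, so the type is only a \<^class>\<open>monoid_mult\<close> and not a \<^class>\<open>real_normed_algebra_1\<close>.
\<close>

typedef (overloaded) 'h bop = "UNIV :: ('h::real_normed_vector \<Rightarrow>\<^sub>L 'h) set"
  by simp

setup_lifting type_definition_bop

lemma blinfun_compose_assoc: "(A o\<^sub>L B) o\<^sub>L C = A o\<^sub>L (B o\<^sub>L C)"
  by (rule blinfun_eqI) simp

lemma id_blinfun_compose: "id_blinfun o\<^sub>L A = A" "A o\<^sub>L id_blinfun = A"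
  by (rule blinfun_eqI, simp)+

instantiation bop :: (real_normed_vector) real_normed_algebra
begin

lift_definition zero_bop :: "'a bop" is 0 .
lift_definition plus_bop :: "'a bop \<Rightarrow> 'a bop \<Rightarrow> 'a bop" is "(+)" .
lift_definition minus_bop :: "'a bop \<Rightarrow> 'a bop \<Rightarrow> 'a bop" is "(-)" .
lift_definition uminus_bop :: "'a bop \<Rightarrow> 'a bop" is uminus .
lift_definition times_bop :: "'a bop \<Rightarrow> 'a bop \<Rightarrow> 'a bop" is "(o\<^sub>L)" .
lift_definition scaleR_bop :: "real \<Rightarrow> 'a bop \<Rightarrow> 'a bop" is scaleR .
lift_definition norm_bop :: "'a bop \<Rightarrow> real" is norm .

definition dist_bop :: "'a bop \<Rightarrow> 'a bop \<Rightarrow> real"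
  where "dist_bop a b = norm (a - b)"

definition
  "(uniformity :: ('a bop \<times> 'a bop) filter) = (INF e\<in>{0 <..}. principal {(x, y). dist x y < e})"

definition open_bop :: "'a bop set \<Rightarrow> bool"
  where "open_bop S = (\<forall>x\<in>S. \<forall>\<^sub>F (x', y) in uniformity. x' = x \<longrightarrow> y \<in> S)"

definition sgn_bop :: "'a bop \<Rightarrow> 'a bop"
  where "sgn_bop x = scaleR (inverse (norm x)) x"

instance
  by standard
    (unfold dist_bop_def open_bop_def sgn_bop_def uniformity_bop_def,
     (rule refl | (transfer, simp add: blinfun_compose_assoc bounded_bilinear_blinfun_compose
        bounded_bilinear.add_left bounded_bilinear.add_right
        bounded_bilinear.scaleR_left bounded_bilinear.scaleR_right
        norm_blinfun_compose norm_triangle_ineq scaleR_left_distrib scaleR_right_distrib))+)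

end

instantiation bop :: (real_normed_vector) monoid_mult
begin

lift_definition one_bop :: "'a bop" is id_blinfun .

instance
  by standard (transfer, simp add: blinfun_compose_assoc id_blinfun_compose)+

end

instance bop :: (banach) banach
proof
  fix X :: "nat \<Rightarrow> 'a bop"
  have dist: "dist (Rep_bop a) (Rep_bop b) = dist a b" for a b :: "'a bop"
    by (simp add: dist_norm norm_bop.rep_eq minus_bop.rep_eq)
  assume "Cauchy X"
  then have "Cauchy (\<lambda>n. Rep_bop (X n))"
    by (simp add: Cauchy_def dist)
  then obtain L where "(\<lambda>n. Rep_bop (X n)) \<longlonglongrightarrow> L"
    using Cauchy_convergent convergentD by blast
  then have "X \<longlonglongrightarrow> Abs_bop L"
    unfolding tendsto_iff by (simp add: Abs_bop_inverse flip: dist)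
  then show "convergent X" by (rule convergentI)
qed

lift_definition app :: "'h::real_normed_vector bop \<Rightarrow> 'h \<Rightarrow> 'h" is blinfun_apply .

lift_definition op_of :: "('h::real_normed_vector \<Rightarrow> 'h) \<Rightarrow> 'h bop" is Blinfun .

lemma app_op_of: "bounded_linear f \<Longrightarrow> app (op_of f) = f"
  by transfer (rule bounded_linear_Blinfun_apply)

lemma bop_eqI: "(\<And>x. app A x = app B x) \<Longrightarrow> A = B"
  by transfer (rule blinfun_eqI)

lemma app_simps [simp]:
  "app 0 x = 0" "app 1 x = x" "app (A + B) x = app A x + app B x"
  "app (A - B) x = app A x - app B x" "app (- A) x = - app A x"
  "app (A * B) x = app A (app B x)" "app (r *\<^sub>R A) x = r *\<^sub>R app A x"
  by (transfer; simp add: blinfun.bilinear_simps)+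

lemma bounded_linear_app: "bounded_linear (app A)"
  by transfer (rule blinfun.bounded_linear_right)

lemmas app_linear_simps [simp] =
  linear_0[OF bounded_linear.linear[OF bounded_linear_app]]
  linear_add[OF bounded_linear.linear[OF bounded_linear_app]]
  linear_diff[OF bounded_linear.linear[OF bounded_linear_app]]
  linear_neg[OF bounded_linear.linear[OF bounded_linear_app]]
  linear_scale[OF bounded_linear.linear[OF bounded_linear_app]]

lemma bounded_linear_app_left: "bounded_linear (\<lambda>A. app A x)"
proof (rule bounded_linear_intro)
  show "norm (app A x) \<le> norm A * norm x" for A
    by transfer (rule norm_blinfun)
qed simp_all

lemma norm_app: "norm (app A x) \<le> norm A * norm x"
  by transfer (rule norm_blinfun)

lemma norm_bop_le: "0 \<le> c \<Longrightarrow> (\<And>x. norm (app A x) \<le> c * norm x) \<Longrightarrow> norm A \<le> c"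
  by transfer (rule norm_blinfun_bound)

section \<open>Square roots by iteration\<close>

text \<open>
  The solution of \<open>2y = a + y\<^sup>2\<close> provides \<open>(1 - y)\<^sup>2 = 1 - a\<close>. It is the limit of the iteration
  \<open>y \<mapsto> (a + y\<^sup>2)/2\<close> from \<open>0\<close>, whose increments are dominated by those of the scalar iteration
  for \<open>a = 1\<close>; hence the case of norm exactly \<open>1\<close> is included.
\<close>

lemma sqrt_iteration:
  fixes a :: "'b::{real_normed_algebra, banach}"
  assumes a: "norm a \<le> 1"
  obtains y where "norm y \<le> 1" "2 *\<^sub>R y = a + y * y"
    "\<And>C. \<lbrakk>closed C; 0 \<in> C; \<And>z. z \<in> C \<Longrightarrow> (1/2) *\<^sub>R (a + z * z) \<in> C\<rbrakk> \<Longrightarrow> y \<in> C"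
proof -
  define f where "f = rec_nat 0 (\<lambda>_ z. (1/2) *\<^sub>R (a + z * z))"
  define s where "s = rec_nat 0 (\<lambda>_ z::real. (1 + z * z) / 2)"
  have f: "f 0 = 0" "f (Suc n) = (1/2) *\<^sub>R (a + f n * f n)" for n
    by (simp_all add: f_def)
  have s: "s 0 = 0" "s (Suc n) = (1 + s n * s n) / 2" for n
    by (simp_all add: s_def)
  have s01: "0 \<le> s n \<and> s n \<le> 1" for n
  proof (induction n)
    case (Suc n)
    then have "s n * s n \<le> 1 * 1" by (intro mult_mono) auto
    then show ?case by (simp add: s)
  qed (simp add: s)
  have fs: "norm (f n) \<le> s n" for n
  proof (induction n)
    case (Suc n)
    have "norm (a + f n * f n) \<le> norm a + norm (f n) * norm (f n)"
      by (meson add_left_mono norm_mult_ineq norm_triangle_le)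
    also have "\<dots> \<le> 1 + s n * s n"
      using a Suc s01 by (intro add_mono mult_mono) auto
    finally show ?case by (simp add: f s)
  qed (simp add: f s)
  have incr: "norm (f (Suc n) - f n) \<le> s (Suc n) - s n" for n
  proof (induction n)
    case 0
    then show ?case using a by (simp add: f s)
  next
    case (Suc n)
    let ?d = "f (Suc n) - f n"
    \<comment> \<open>The difference of two squares is split in a way that is valid without
      commutativity.\<close>
    have "f (Suc (Suc n)) - f (Suc n) = (1/2) *\<^sub>R (f (Suc n) * ?d + ?d * f n)"
      by (simp add: f(2)[of "Suc n"] f(2)[of n] algebra_simps)
    moreover have "norm (f (Suc n) * ?d + ?d * f n)
        \<le> norm (f (Suc n)) * norm ?d + norm ?d * norm (f n)"
      by (intro order_trans[OF norm_triangle_ineq] add_mono norm_mult_ineq)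
    moreover have "\<dots> \<le> s (Suc n) * (s (Suc n) - s n) + (s (Suc n) - s n) * s n"
      using Suc fs s01 order_trans[OF norm_ge_zero Suc] by (intro add_mono mult_mono) auto
    moreover have "\<dots> = 2 * (s (Suc (Suc n)) - s (Suc n))"
      by (simp add: s(2)[of "Suc n"] s(2)[of n] field_simps)
    ultimately show ?case by simp
  qed
  have "s n \<le> s (Suc n)" for n
    using order_trans[OF norm_ge_zero incr[of n]] by simp
  then have "incseq s" by (rule incseq_SucI)
  then have "convergent s"
    using s01 by (intro Bseq_mono_convergent BseqI'[where K = 1]) (auto simp: incseq_def)
  then have "summable (\<lambda>n. s (Suc n) - s n)"
    unfolding convergent_def by (auto intro: telescope_summable)
  then have "summable (\<lambda>n. f (Suc n) - f n)"
    using incr by (rule summable_comparison_test'[where N = 0])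
  then have "(\<lambda>n. \<Sum>i<n. f (Suc i) - f i) \<longlonglongrightarrow> (\<Sum>i. f (Suc i) - f i)"
    by (rule summable_LIMSEQ)
  then have y: "f \<longlonglongrightarrow> (\<Sum>i. f (Suc i) - f i)" (is "_ \<longlonglongrightarrow> ?y")
    by (simp add: sum_lessThan_telescope f(1))
  define y where "y = ?y"
  note y = y[folded y_def]
  have "(\<lambda>n. f (Suc n)) \<longlonglongrightarrow> (1/2) *\<^sub>R (a + y * y)"
    unfolding f(2) by (intro tendsto_intros y)
  then have "y = (1/2) *\<^sub>R (a + y * y)"
    by (rule LIMSEQ_unique[OF LIMSEQ_Suc[OF y]])
  then have "2 *\<^sub>R y = 2 *\<^sub>R ((1/2) *\<^sub>R (a + y * y))" by (rule arg_cong)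
  then have eq: "2 *\<^sub>R y = a + y * y" by simp
  have "norm (f n) \<le> 1" for n
    using fs[of n] s01[of n] by linarith
  then have norm: "norm y \<le> 1"
    by (intro Lim_bounded[OF tendsto_norm[OF y]]) auto
  \<comment> \<open>Used later with \<open>C\<close> the set of symmetric operators and with
    \<open>C\<close> the commutant of one operator.\<close>
  have "y \<in> C" if "closed C" "0 \<in> C" "\<And>z. z \<in> C \<Longrightarrow> (1/2) *\<^sub>R (a + z * z) \<in> C" for C
  proof -
    have "f n \<in> C" for n by (induction n) (auto simp: f that)
    then show ?thesis using that(1) y by (intro closed_sequentially[of C f y]) auto
  qed
  with norm eq show thesis by (rule that)
qed

section \<open>Inner products\<close>

lemma scaleC_zero_left [simp]: "0 *\<^sub>C x = (0 :: 'a::complex_vector)"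
  using scaleC_add_left[of 0 0 x] by simp

lemma scaleC_zero_right [simp]: "c *\<^sub>C 0 = (0 :: 'a::complex_vector)"
  using scaleC_add_right[of c 0 0] by simp

lemma scaleC_minus_one: "(-1) *\<^sub>C x = - (x :: 'a::complex_vector)"
  using scaleR_scaleC[of "-1" x] by simp

lemma scaleC_minus_right: "c *\<^sub>C (- x) = - (c *\<^sub>C (x :: 'a::complex_vector))"
  using scaleC_add_right[of c x "- x"] by (simp add: eq_neg_iff_add_eq_0 add.commute)

lemma scaleC_diff_right: "c *\<^sub>C (x - y) = c *\<^sub>C x - c *\<^sub>C (y :: 'a::complex_vector)"
  using scaleC_add_right[of c x "- y"] by (simp add: scaleC_minus_right)

lemma scaleC_ii_ii [simp]: "\<i> *\<^sub>C \<i> *\<^sub>C x = - (x :: 'a::complex_vector)"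
  by (simp add: scaleC_scaleC scaleC_minus_one)

lemma scaleC_minus_ii: "(- \<i>) *\<^sub>C x = - (\<i> *\<^sub>C (x :: 'a::complex_vector))"
  using scaleC_scaleC[of "-1" \<i> x] by (simp add: scaleC_minus_one)

lemma scaleC_scaleR_commute: "c *\<^sub>C r *\<^sub>R x = r *\<^sub>R c *\<^sub>C (x :: 'a::complex_vector)"
  by (simp add: scaleR_scaleC scaleC_scaleC mult.commute)

lemma bounded_linear_scaleC: "bounded_linear (scaleC c :: 'a::complex_normed_vector \<Rightarrow> 'a)"
  by (rule bounded_linear_intro[of _ "cmod c"])
    (simp_all add: scaleC_add_right scaleC_scaleR_commute norm_scaleC mult.commute)

lemma star_zero [simp]: "star (0 :: 'a::cstar_algebra) = 0"
  using star_add[of "0::'a" 0] by simp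

text \<open>The C*-identity and submultiplicativity give one inequality; applying it to
  \<open>star a\<close> gives the other.\<close>

lemma norm_star [simp]: "norm (star a) = norm (a :: 'a::cstar_algebra)"
proof -
  have le: "norm x \<le> norm (star x)" for x :: 'a
  proof (cases "x = 0")
    case False
    have "norm x * norm x \<le> norm (star x) * norm x"
      using norm_mult_ineq[of "star x" x] cstar_identity[of x] by (simp add: power2_eq_square)
    with False show ?thesis by simp
  qed simp
  show ?thesis using le[of a] le[of "star a"] by (simp add: star_star)
qed

context hilbert_module
begin

lemma ip_zero_right [simp]: "ip x 0 = 0"
  using ip_add_right[of x 0 0] by simp

lemma ip_zero_left [simp]: "ip 0 x = 0"
  by (metis ip_star ip_zero_right star_zero)

lemma ip_add_left: "ip (x + y) z = ip x z + ip y z"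
  by (metis ip_add_right ip_star star_add)

lemma ip_scaleC_left: "ip (c *\<^sub>C x) y = cnj c *\<^sub>C ip x y"
  by (metis ip_scaleC_right ip_star star_scaleC)

lemma ip_minus_right: "ip x (- y) = - ip x y"
  using ip_add_right[of x y "- y"] by (simp add: eq_neg_iff_add_eq_0 add.commute)

lemma ip_minus_left: "ip (- x) y = - ip x y"
  using ip_add_left[of x "- x" y] by (simp add: eq_neg_iff_add_eq_0 add.commute)

lemma ip_diff_right: "ip x (y - z) = ip x y - ip x z"
  using ip_add_right[of x y "- z"] by (simp add: ip_minus_right)

lemma ip_diff_left: "ip (x - y) z = ip x z - ip y z"
  using ip_add_left[of x "- y" z] by (simp add: ip_minus_left)

lemma ip_scaleR_right: "ip x (r *\<^sub>R y) = r *\<^sub>R ip x y"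
  by (simp add: scaleR_scaleC ip_scaleC_right)

lemma ip_scaleR_left: "ip (r *\<^sub>R x) y = r *\<^sub>R ip x y"
  by (simp add: scaleR_scaleC ip_scaleC_left)

lemmas ip_simps = ip_add_left ip_add_right ip_diff_left ip_diff_right ip_minus_left ip_minus_right
  ip_scaleR_left ip_scaleR_right ip_scaleC_left ip_scaleC_right

lemma norm_power2_ip: "(norm x)\<^sup>2 = norm (ip x x)"
  by (simp add: norm_eq_sqrt_ip)

lemma ip_eqI: "(\<And>z. ip z x = ip z y) \<Longrightarrow> x = y"
  using ip_definite[of "x - y"] by (simp add: ip_diff_right)

lemma ip_eqI_left: "(\<And>z. ip x z = ip y z) \<Longrightarrow> x = y"
  using ip_definite[of "x - y"] by (simp add: ip_diff_left)

text \<open>A relation instead of a function, since a bounded operator on a Hilbert module may have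
  no adjoint.\<close>

definition adj_pair :: "'h bop \<Rightarrow> 'h bop \<Rightarrow> bool" where
  "adj_pair A B \<longleftrightarrow> (\<forall>x y. ip (app A x) y = ip x (app B y))"

definition sa :: "'h bop \<Rightarrow> bool" where
  "sa A \<longleftrightarrow> adj_pair A A"

lemma sa_ip: "sa A \<Longrightarrow> ip (app A x) y = ip x (app A y)"
  by (simp add: sa_def adj_pair_def)

lemma saI: "(\<And>x y. ip (app A x) y = ip x (app A y)) \<Longrightarrow> sa A"
  by (simp add: sa_def adj_pair_def)

lemma sa_simps [intro, simp]:
  "sa 0" "sa 1" "sa A \<Longrightarrow> sa B \<Longrightarrow> sa (A + B)" "sa A \<Longrightarrow> sa B \<Longrightarrow> sa (A - B)"
  "sa A \<Longrightarrow> sa (- A)" "sa A \<Longrightarrow> sa (r *\<^sub>R A)" "sa A \<Longrightarrow> sa (A * A)"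
  by (auto simp: sa_def adj_pair_def ip_simps)

lemma sa_mult: "sa A \<Longrightarrow> sa B \<Longrightarrow> A * B = B * A \<Longrightarrow> sa (A * B)"
  by (rule saI) (metis sa_ip app_simps(6))

lemma adj_pair_sym: "adj_pair A B \<Longrightarrow> adj_pair B A"
  unfolding adj_pair_def by (metis ip_star)

lemma adj_pair_mult: "adj_pair A A' \<Longrightarrow> adj_pair B B' \<Longrightarrow> adj_pair (A * B) (B' * A')"
  by (simp add: adj_pair_def)

lemma sa_adj_mult: "adj_pair A A' \<Longrightarrow> sa (A' * A)"
  unfolding sa_def using adj_pair_mult adj_pair_sym by blast

text \<open>Elements of \<open>'h bop\<close> are only real linear; having an adjoint forces complex
  linearity.\<close>

lemma adj_pair_scaleC: "adj_pair A A' \<Longrightarrow> app A (c *\<^sub>C x) = c *\<^sub>C app A x"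
  by (rule ip_eqI_left) (simp add: adj_pair_def ip_simps)

end

section \<open>The order on adjointable operators\<close>

text \<open>Cauchy-Schwarz is assumed here because its general proof rests on the results below for
  the algebra acting on itself, where the inequality is immediate.\<close>

locale cs_module = hilbert_module act ip
  for act :: "'h::complex_banach \<Rightarrow> 'a::cstar_algebra \<Rightarrow> 'h" and ip +
  assumes cauchy_schwarz: "norm (ip x y) \<le> norm x * norm y"
begin

lemma bounded_linear_ip_right: "bounded_linear (ip x)"
  by (rule bounded_linear_intro[of _ "norm x"])
    (use cauchy_schwarz[of x] in \<open>simp_all add: ip_simps mult.commute[of "norm x"]\<close>)

lemma bounded_linear_ip_left: "bounded_linear (\<lambda>x. ip x y)"
  by (rule bounded_linear_intro[of _ "norm y"])
    (use cauchy_schwarz in \<open>simp_all add: ip_simps\<close>)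

lemma closed_sa: "closed {A. sa A}"
proof -
  have "closed {A. ip (app A x) y = ip x (app A y)}" for x y
    by (intro closed_Collect_eq linear_continuous_on bounded_linear_app_left
        bounded_linear_compose[OF bounded_linear_ip_left]
        bounded_linear_compose[OF bounded_linear_ip_right])
  then show ?thesis
    unfolding sa_def adj_pair_def by (intro closed_Collect_all)
qed

lemma norm_app_adj:
  assumes "adj_pair A A'"
  shows "(norm (app A x))\<^sup>2 \<le> norm (A' * A) * (norm x)\<^sup>2"
proof -
  have "(norm (app A x))\<^sup>2 = norm (ip x (app (A' * A) x))"
    using assms by (simp add: norm_power2_ip adj_pair_def)
  also have "\<dots> \<le> norm x * (norm (A' * A) * norm x)"
    using cauchy_schwarz norm_app by (meson mult_left_mono norm_ge_zero order_trans)
  finally show ?thesis by (simp add: power2_eq_square mult_ac)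
qed

text \<open>Cauchy-Schwarz yields this half of the C*-identity, pointwise and then for operator
  norms.\<close>

lemma norm_adj_mult:
  assumes "adj_pair A A'"
  shows "(norm A)\<^sup>2 \<le> norm (A' * A)"
proof -
  have "norm A \<le> sqrt (norm (A' * A))"
  proof (rule norm_bop_le)
    show "norm (app A x) \<le> sqrt (norm (A' * A)) * norm x" for x
      using real_sqrt_le_mono[OF norm_app_adj[OF assms, of x]] by (simp add: real_sqrt_mult)
  qed simp
  then show ?thesis
    by (metis norm_ge_zero power_mono real_sqrt_pow2)
qed

lemma norm_adj_eq:
  assumes "adj_pair A A'"
  shows "norm A' = norm A"
proof -
  have le: "norm C \<le> norm B" if "adj_pair B C" for B C
  proof (cases "C = 0")
    case False
    have "norm C * norm C \<le> norm B * norm C"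
      using norm_adj_mult[OF adj_pair_sym[OF that]] norm_mult_ineq[of B C]
      by (simp add: power2_eq_square)
    with False show ?thesis by simp
  qed simp
  show ?thesis using le[OF assms] le[OF adj_pair_sym[OF assms]] by simp
qed

lemma norm_sa_square: "sa A \<Longrightarrow> norm (A * A) = (norm A)\<^sup>2"
  using norm_adj_mult[of A A] norm_mult_ineq[of A A] by (simp add: sa_def power2_eq_square)

lemma sa_square_zero: "sa A \<Longrightarrow> A * A = 0 \<Longrightarrow> A = 0"
  using norm_sa_square[of A] by simp

text \<open>
  If the sum of the squares is \<open>t\<close>, then \<open>k + \<i>l\<close> and \<open>k - \<i>l\<close> are \<open>\<surd>t\<close> times an isometry,
  and \<open>k\<close> is their mean.
\<close>

lemma norm_le_of_sum_squares:
  assumes k: "sa k" and l: "sa l" and kl: "k * l = l * k"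
    and t: "k * k + l * l = t *\<^sub>R 1" "0 \<le> t"
  shows "norm k \<le> sqrt t"
proof (rule norm_bop_le)
  fix x
  let ?p = "app k x" and ?q = "app l x"
  \<comment> \<open>This makes the cross terms cancel in the two expansions below.\<close>
  have pq: "ip ?p ?q = ip ?q ?p"
    using k l arg_cong[OF kl, of "\<lambda>A. app A x"] by (simp add: sa_ip)
  have sum: "ip ?p ?p + ip ?q ?q = t *\<^sub>R ip x x"
    using k l arg_cong[OF t(1), of "\<lambda>A. ip x (app A x)"] by (simp add: sa_ip ip_simps)
  have "ip (?p + \<i> *\<^sub>C ?q) (?p + \<i> *\<^sub>C ?q) = t *\<^sub>R ip x x"
    "ip (?p - \<i> *\<^sub>C ?q) (?p - \<i> *\<^sub>C ?q) = t *\<^sub>R ip x x"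
    unfolding sum[symmetric]
    by (simp_all add: ip_simps pq scaleC_add_right scaleC_minus_ii scaleC_diff_right)
  then have "norm (?p + \<i> *\<^sub>C ?q) = sqrt t * norm x" "norm (?p - \<i> *\<^sub>C ?q) = sqrt t * norm x"
    using t(2) by (simp_all add: norm_eq_sqrt_ip real_sqrt_mult)
  moreover have "2 *\<^sub>R ?p = (?p + \<i> *\<^sub>C ?q) + (?p - \<i> *\<^sub>C ?q)"
    by (simp add: scaleR_2)
  then have "2 * norm ?p \<le> norm (?p + \<i> *\<^sub>C ?q) + norm (?p - \<i> *\<^sub>C ?q)"
    by (metis norm_scaleR norm_triangle_ineq abs_numeral)
  ultimately show "norm ?p \<le> sqrt t * norm x" by simp
qed (use t in simp)

section \<open>The cone of positive operators, its square roots and its order\<close>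

text \<open>
  Equivalent to self-adjointness and nonnegative spectrum, but evidently stable under addition.
\<close>

definition pos :: "'h bop \<Rightarrow> bool" where
  "pos h \<longleftrightarrow> sa h \<and> (\<exists>t>0. norm (t *\<^sub>R 1 - h) \<le> t)"

lemma pos_sa: "pos h \<Longrightarrow> sa h"
  by (simp add: pos_def)

lemma pos_add: "pos h \<Longrightarrow> pos k \<Longrightarrow> pos (h + k)"
proof -
  assume "pos h" "pos k"
  then obtain s t where st: "s > 0" "t > 0" "norm (s *\<^sub>R 1 - h) \<le> s" "norm (t *\<^sub>R 1 - k) \<le> t"
    and sa: "sa h" "sa k"
    by (auto simp: pos_def)
  have "norm ((s + t) *\<^sub>R 1 - (h + k)) = norm ((s *\<^sub>R 1 - h) + (t *\<^sub>R 1 - k))"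
    by (simp add: algebra_simps)
  also have "\<dots> \<le> s + t"
    using st norm_triangle_ineq order_trans add_mono by meson
  finally show ?thesis
    using st sa unfolding pos_def by (auto intro!: exI[of _ "s + t"])
qed

lemma pos_scaleR: "pos h \<Longrightarrow> r > 0 \<Longrightarrow> pos (r *\<^sub>R h)"
proof -
  assume "pos h" and r: "r > 0"
  then obtain t where t: "t > 0" "norm (t *\<^sub>R 1 - h) \<le> t" "sa h"
    by (auto simp: pos_def)
  have "norm ((r * t) *\<^sub>R 1 - r *\<^sub>R h) = r * norm (t *\<^sub>R 1 - h)"
    using r norm_scaleR[of r "t *\<^sub>R 1 - h"] by (simp add: algebra_simps)
  then show ?thesis
    using t r unfolding pos_def by (auto intro!: exI[of _ "r * t"])
qed

lemma pos_norm_minus: "sa h \<Longrightarrow> norm h \<le> t \<Longrightarrow> 0 < t \<Longrightarrow> pos (t *\<^sub>R 1 - h)"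
  unfolding pos_def by (auto intro!: exI[of _ t])

text \<open>Rescaling \<open>h\<close> to \<open>1 - a\<close> with \<open>norm a \<le> 1\<close>
  lets the iteration apply. The root inherits every commutation relation of \<open>h\<close>,
  because commutants are closed and stable under the iteration.\<close>

lemma pos_sqrt:
  assumes "pos h"
  obtains k where "pos k" "k * k = h" "\<And>b. b * h = h * b \<Longrightarrow> b * k = k * b"
proof -
  obtain t where t: "t > 0" "norm (t *\<^sub>R 1 - h) \<le> t" and h: "sa h"
    using assms by (auto simp: pos_def)
  define a where "a = 1 - (1/t) *\<^sub>R h"
  have a_eq: "a = (1/t) *\<^sub>R (t *\<^sub>R 1 - h)"
    using t by (simp add: a_def algebra_simps)
  have "norm a \<le> 1"
    using t unfolding a_eq by simp
  then obtain y where y: "norm y \<le> 1" "2 *\<^sub>R y = a + y * y"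
    "\<And>C. \<lbrakk>closed C; 0 \<in> C; \<And>z. z \<in> C \<Longrightarrow> (1/2) *\<^sub>R (a + z * z) \<in> C\<rbrakk> \<Longrightarrow> y \<in> C"
    by (rule sqrt_iteration) blast
  have "sa a" using h by (simp add: a_def)
  then have "y \<in> {A. sa A}"
    by (intro y(3) closed_sa) auto
  then have sa: "sa y" by simp
  have comm: "b * y = y * b" if "b * h = h * b" for b
  proof -
    have "b * a = a * b" using that by (simp add: a_def algebra_simps)
    moreover have "b * (z * z) = z * z * b" if "b * z = z * b" for z
      by (metis mult.assoc that)
    ultimately have "y \<in> {z. b * z = z * b}"
      by (intro y(3) closed_Collect_eq continuous_intros) (auto simp: algebra_simps)
    then show ?thesis by simp
  qed
  define k where "k = sqrt t *\<^sub>R (1 - y)"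
  have "(1 - y) * (1 - y) = 1 - (2 *\<^sub>R y - y * y)"
    by (simp add: algebra_simps scaleR_2)
  then have "(1 - y) * (1 - y) = (1/t) *\<^sub>R h"
    by (simp add: y(2) a_def)
  then have "k * k = h" using t by (simp add: k_def)
  moreover have "norm (sqrt t *\<^sub>R 1 - k) = sqrt t * norm y"
    using t by (simp add: k_def algebra_simps)
  then have "norm (sqrt t *\<^sub>R 1 - k) \<le> sqrt t"
    using y(1) t by (simp add: mult_left_le)
  then have "pos k"
    unfolding pos_def using sa t by (auto simp: k_def intro!: exI[of _ "sqrt t"])
  moreover have "b * k = k * b" if "b * h = h * b" for b
    using comm[OF that] by (simp add: k_def algebra_simps)
  ultimately show thesis using that by blast
qed

text \<open>The root \<open>s\<close> of \<open>t - k * k\<close> commutes with \<open>k\<close>,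
  and the two squares add up to \<open>t\<close>; hence \<open>norm s \<le> sqrt t\<close>.\<close>

lemma norm_minus_square:
  assumes k: "sa k" and t: "(norm k)\<^sup>2 \<le> t" "0 < t"
  shows "norm (t *\<^sub>R 1 - k * k) \<le> t"
proof -
  have "pos (t *\<^sub>R 1 - k * k)"
    using k t by (intro pos_norm_minus) (auto simp: norm_sa_square)
  then obtain s where s: "pos s" "s * s = t *\<^sub>R 1 - k * k"
    and comm: "\<And>b. b * (t *\<^sub>R 1 - k * k) = (t *\<^sub>R 1 - k * k) * b \<Longrightarrow> b * s = s * b"
    by (rule pos_sqrt) blast
  have "k * s = s * k" by (rule comm) (simp add: algebra_simps)
  then have "norm s \<le> sqrt t"
    using k s t by (intro norm_le_of_sum_squares[of s k]) (auto simp: pos_sa)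
  then have "(norm s)\<^sup>2 \<le> t"
    using t by (metis norm_ge_zero order_less_imp_le power_mono real_sqrt_pow2)
  then show ?thesis
    using norm_sa_square[OF pos_sa[OF s(1)]] s(2) by simp
qed

text \<open>The summand 1 in the witness keeps it strictly positive when
  \<open>k = 0\<close>.\<close>

lemma pos_square: "sa k \<Longrightarrow> pos (k * k)"
  unfolding pos_def
  by (auto intro!: exI[of _ "(norm k)\<^sup>2 + 1"] norm_minus_square add_nonneg_pos)

text \<open>Frees the existential \<open>t\<close> in \<open>pos\<close>: every positive bound of
  the norm will do.\<close>

lemma pos_norm_diff_le:
  assumes "pos h" "norm h \<le> t" "0 < t"
  shows "norm (t *\<^sub>R 1 - h) \<le> t"
proof -
  obtain k where k: "pos k" "k * k = h"
    using assms(1) by (rule pos_sqrt) blast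
  then show ?thesis
    using norm_minus_square[of k t] norm_sa_square[of k] assms pos_sa by auto
qed

text \<open>The roots of \<open>a\<close> and \<open>t - a\<close> commute and their squares add up
  to \<open>t\<close>.\<close>

lemma pos_le_norm_le:
  assumes "pos a" "pos (t *\<^sub>R 1 - a)" "0 \<le> t"
  shows "norm a \<le> t"
proof -
  obtain k where k: "pos k" "k * k = a" "\<And>b. b * a = a * b \<Longrightarrow> b * k = k * b"
    using assms(1) by (rule pos_sqrt) blast
  obtain l where l: "pos l" "l * l = t *\<^sub>R 1 - a"
    "\<And>b. b * (t *\<^sub>R 1 - a) = (t *\<^sub>R 1 - a) * b \<Longrightarrow> b * l = l * b"
    using assms(2) by (rule pos_sqrt) blast
  have "k * a = a * k" by (simp add: mult.assoc flip: k(2))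
  then have "k * l = l * k"
    by (intro l(3)) (simp add: algebra_simps)
  then have "norm k \<le> sqrt t"
    using k(1,2) l(1,2) assms(3) by (intro norm_le_of_sum_squares[of k l]) (auto simp: pos_sa)
  then have "(norm k)\<^sup>2 \<le> t"
    using assms(3) by (metis norm_ge_zero power_mono real_sqrt_pow2)
  then show ?thesis
    using norm_sa_square[OF pos_sa[OF k(1)]] k(2) by simp
qed

text \<open>The cone is proper: this is the preceding bound at \<open>t = 0\<close>.\<close>

lemma pos_antisym:
  assumes "pos h" "pos (- h)"
  shows "h = 0"
  using pos_le_norm_le[of h 0] assms by simp

lemma pos_mono_norm:
  assumes "pos a" "pos (b - a)"
  shows "norm a \<le> norm b"
\<comment> \<open>The slack \<open>e\<close> makes the bound strictly positive, as
  \<open>pos_norm_minus\<close> demands, even if \<open>b = 0\<close>.\<close>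
proof (rule field_le_epsilon)
  fix e :: real assume e: "e > 0"
  let ?t = "norm b + e"
  have "sa ((b - a) + a)"
    using assms pos_sa by blast
  then have "sa b" by simp
  then have "pos (?t *\<^sub>R 1 - b)"
    using e by (intro pos_norm_minus) (auto intro: add_nonneg_pos)
  then have "pos ((?t *\<^sub>R 1 - b) + (b - a))"
    using assms(2) by (rule pos_add)
  then show "norm a \<le> ?t"
    using e assms(1) by (intro pos_le_norm_le) (auto simp: add_nonneg_nonneg)
qed

lemma pos_sqrt_unique:
  assumes "pos a" "pos b" "a * a = b * b"
  shows "a = b"
proof -
  \<comment> \<open>For commuting roots with difference \<open>d\<close>, the positive elements
    \<open>d * c * d\<close> and \<open>d * s * d\<close> add up to 0, so both vanish. Their
    difference is the cube of \<open>d\<close>, and a symmetric element with vanishing fourth power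
    is 0.\<close>
  have eq: "c = s" if c: "pos c" and s: "pos s" and cs: "c * c = s * s" "c * s = s * c" for c s
  proof -
    let ?d = "c - s"
    have d: "sa ?d" using c s by (simp add: pos_sa)
    have conj: "pos (?d * x * ?d)" if x: "pos x" "x * c = c * x" "x * s = s * x" for x
    proof -
      obtain r where r: "pos r" "r * r = x" "\<And>b. b * x = x * b \<Longrightarrow> b * r = r * b"
        using x(1) by (rule pos_sqrt) blast
      have "?d * r = r * ?d"
        by (rule r(3)) (simp add: algebra_simps x)
      moreover from this have "sa (?d * r)"
        using d r(1) by (intro sa_mult) (auto simp: pos_sa)
      ultimately show ?thesis
        using pos_square[of "?d * r"] r(2) by (metis mult.assoc)
    qed
    have *: "pos (?d * c * ?d)" "pos (?d * s * ?d)"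
      using conj[of c] conj[of s] c s cs by auto
    have "?d * (c + s) = 0" using cs by (simp add: algebra_simps)
    then have "?d * (c + s) * ?d = 0" by simp
    then have "?d * c * ?d + ?d * s * ?d = 0" by (simp only: distrib_left distrib_right)
    then have neg: "?d * c * ?d = - (?d * s * ?d)" by (simp only: eq_neg_iff_add_eq_0)
    then have "?d * s * ?d = 0" using * by (intro pos_antisym) auto
    moreover from this neg have "?d * c * ?d = 0" by simp
    ultimately have "?d * c * ?d - ?d * s * ?d = 0" by simp
    then have "?d * ?d * ?d = 0"
      by (simp only: left_diff_distrib[of _ _ ?d, symmetric] right_diff_distrib[of ?d, symmetric])
    then have "?d * ?d * ?d * ?d = 0" by simp
    then have "(?d * ?d) * (?d * ?d) = 0" by (simp only: mult.assoc)
    then have "?d = 0" using d sa_square_zero sa_simps(7) by blast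
    then show ?thesis by simp
  qed
  \<comment> \<open>\<open>a\<close> and \<open>b\<close> are not known to commute, but this root
    commutes with both, so each is compared with it.\<close>
  obtain k where k: "pos k" "k * k = a * a"
    "\<And>x. x * (a * a) = (a * a) * x \<Longrightarrow> x * k = k * x"
    using pos_square[OF pos_sa[OF assms(1)]] by (rule pos_sqrt) blast
  have "a * k = k * a" by (rule k(3)) (simp add: mult.assoc)
  then have "a = k" using assms k(1,2) by - (rule eq, auto)
  moreover have "b * k = k * b" by (rule k(3)) (simp add: mult.assoc assms(3))
  then have "b = k" using assms k(1,2) by - (rule eq, auto)
  ultimately show ?thesis by simp
qed

section \<open>Kaplansky's argument\<close>

text \<open>
  Here \<open>w = |h| - h\<close> and \<open>r = \<surd>|h|\<close>; so \<open>w\<close> is twice the negative part of \<open>h\<close>.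
\<close>

lemma negative_part:
  assumes h: "sa h"
  obtains r w where "sa r" "sa w" "sa (r * w)" "w * h * w = - ((r * w) * (r * w))"
    "r * w = 0 \<Longrightarrow> pos h"
proof -
  obtain m where m: "pos m" "m * m = h * h" "\<And>x. x * (h * h) = (h * h) * x \<Longrightarrow> x * m = m * x"
    using pos_square[OF h] by (rule pos_sqrt) blast
  obtain r where r: "pos r" "r * r = m" "\<And>x. x * m = m * x \<Longrightarrow> x * r = r * x"
    using m(1) by (rule pos_sqrt) blast
  define w where "w = m - h"
  have hm: "h * m = m * h" by (rule m(3)) (simp add: mult.assoc)
  have hr: "h * r = r * h" by (rule r(3)[OF hm])
  have mr: "m * r = r * m" by (rule r(3)) simp
  have rw: "r * w = w * r" by (simp add: w_def algebra_simps hr mr)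
  have sw: "sa w" using h m(1) by (simp add: w_def pos_sa)
  have srw: "sa (r * w)" using rw sw r(1) by (intro sa_mult) (auto simp: pos_sa)
  have "h * w = - (m * w)" by (simp add: w_def algebra_simps m(2) hm)
  then have "w * h * w = - (w * (r * r) * w)" by (simp add: r(2) mult.assoc)
  also have "w * (r * r) * w = (r * w) * (r * w)" by (metis rw mult.assoc)
  finally have eq: "w * h * w = - ((r * w) * (r * w))" .
  \<comment> \<open>Then \<open>w * w = 0\<close>, so \<open>h\<close> equals its absolute value
    \<open>m\<close>.\<close>
  have "pos h" if "r * w = 0"
  proof -
    have "m * w = 0" using that by (simp add: mult.assoc flip: r(2))
    then have "m * m = m * h" by (simp add: w_def right_diff_distrib)
    then have "w * w = 0"
      by (simp add: w_def algebra_simps hm m(2))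
    then have "m = h" using sa_square_zero[OF sw] by (simp add: w_def)
    then show ?thesis using m(1) by simp
  qed
  then show thesis using that pos_sa r(1) sw srw eq by blast
qed

text \<open>Up to sign, \<open>c\<close> and \<open>d\<close> are twice the real and imaginary parts
  of \<open>x\<close>, and \<open>c * c + d * d\<close> is twice the sum in question.\<close>

lemma pos_adj_sum:
  assumes "adj_pair x x'"
  shows "pos (x' * x + x * x')"
proof -
  \<comment> \<open>\<open>'h bop\<close> is a real algebra, so the imaginary unit enters as an
    operator.\<close>
  define J :: "'h bop" where "J = op_of (scaleC \<i>)"
  have J: "app J v = \<i> *\<^sub>C v" for v
    by (simp add: J_def app_op_of bounded_linear_scaleC)
  have xx': "ip (app x u) v = ip u (app x' v)" "ip (app x' u) v = ip u (app x v)" for u v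
    using assms adj_pair_sym[OF assms] by (auto simp: adj_pair_def)
  have xJ: "x * J = J * x" "x' * J = J * x'"
    by (rule bop_eqI, simp add: J adj_pair_scaleC[OF assms] adj_pair_scaleC[OF adj_pair_sym[OF assms]])+
  have JJ: "J * J = - 1" by (rule bop_eqI) (simp add: J)
  define c d where "c = x + x'" and "d = J * (x - x')"
  have "sa c" by (rule saI) (simp add: c_def ip_simps xx')
  moreover have "sa d"
    by (rule saI)
      (simp add: d_def ip_simps xx' J adj_pair_scaleC[OF assms] scaleC_minus_ii
        adj_pair_scaleC[OF adj_pair_sym[OF assms]])
  ultimately have "pos (c * c + d * d)" by (intro pos_add pos_square)
  moreover have "(x - x') * J = J * (x - x')"
    by (simp add: algebra_simps xJ)
  then have "J * ((x - x') * J) * (x - x') = J * (J * (x - x')) * (x - x')" by simp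
  then have "d * d = J * J * ((x - x') * (x - x'))"
    by (simp only: d_def mult.assoc)
  then have "c * c + d * d = 2 *\<^sub>R (x' * x + x * x')"
    by (simp add: JJ c_def algebra_simps scaleR_2)
  ultimately have "pos ((1/2) *\<^sub>R 2 *\<^sub>R (x' * x + x * x'))"
    by (intro pos_scaleR[of "2 *\<^sub>R (x' * x + x * x')"]) auto
  then show ?thesis by simp
qed

text \<open>
  Put \<open>t = \<parallel>q\<parallel>\<^sup>2\<close>. As \<open>x x'\<close> is positive, \<open>(t - x x') x = x (t + q\<^sup>2)\<close> has norm at most \<open>t \<surd>t\<close>.
  This bounds \<open>q\<^sup>2 (t + q\<^sup>2)\<^sup>2 \<ge> 2 t q\<^sup>4\<close> by \<open>t\<^sup>3\<close>, while \<open>2 t q\<^sup>4\<close> has norm \<open>2 t\<^sup>3\<close>.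
\<close>

lemma adj_square_negative:
  assumes x: "adj_pair x x'" and q: "sa q" and eq: "x' * x = - (q * q)"
  shows "q = 0"
proof (rule ccontr)
  assume "q \<noteq> 0"
  define t where "t = (norm q)\<^sup>2"
  have t: "t > 0" using \<open>q \<noteq> 0\<close> by (simp add: t_def)
  \<comment> \<open>Adding \<open>q * q\<close> cancels \<open>x' * x\<close> and leaves
    \<open>x * x'\<close>.\<close>
  have "pos ((x' * x + x * x') + q * q)"
    using pos_adj_sum[OF x] pos_square[OF q] by (rule pos_add)
  then have posxx': "pos (x * x')" by (simp add: eq)
  have "(norm x)\<^sup>2 \<le> t"
    using norm_adj_mult[OF x] by (simp add: eq norm_sa_square[OF q] t_def)
  moreover have "norm (x * x') \<le> (norm x)\<^sup>2"
    using norm_mult_ineq[of x x'] norm_adj_eq[OF x] by (simp add: power2_eq_square)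
  ultimately have "norm (t *\<^sub>R 1 - x * x') \<le> t"
    using posxx' t by (intro pos_norm_diff_le) auto
  moreover have comm: "(t *\<^sub>R 1 - x * x') * x = x * (t *\<^sub>R 1 + q * q)"
    using eq by (simp add: algebra_simps)
  ultimately have le: "norm (x * (t *\<^sub>R 1 + q * q)) \<le> t * norm x"
    unfolding comm[symmetric]
    by (meson norm_mult_ineq mult_right_mono norm_ge_zero order_trans)
  define g where "g = q * (t *\<^sub>R 1 + q * q)"
  have sg: "sa g" unfolding g_def using q by (intro sa_mult) (auto simp: algebra_simps)
  have g2: "g * g = (t *\<^sub>R 1 + q * q) * (q * q) * (t *\<^sub>R 1 + q * q)"
    by (simp add: g_def algebra_simps)
  have "norm g \<le> t * norm x"
  proof (rule norm_bop_le)
    fix v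
    \<comment> \<open>As \<open>x\<close> and \<open>q\<close> send each vector to vectors of equal
      norm, the bound on \<open>x * (t + q * q)\<close> carries over to \<open>g\<close>.\<close>
    have "ip (app x u) (app x u) = - ip (app q u) (app q u)" for u
    proof -
      have "ip (app x u) (app x u) = ip u (app (x' * x) u)"
        using x by (simp add: adj_pair_def)
      also have "\<dots> = - ip (app q u) (app q u)"
        using q by (simp add: eq sa_ip ip_simps)
      finally show ?thesis .
    qed
    then have "norm (app x u) = norm (app q u)" for u
      by (simp add: norm_eq_sqrt_ip)
    from this[of "app (t *\<^sub>R 1 + q * q) v"]
    have "norm (app g v) = norm (app (x * (t *\<^sub>R 1 + q * q)) v)"
      by (simp only: g_def app_simps(6))
    also have "\<dots> \<le> norm (x * (t *\<^sub>R 1 + q * q)) * norm v" by (rule norm_app)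
    also have "\<dots> \<le> t * norm x * norm v" using le by (rule mult_right_mono) simp
    finally show "norm (app g v) \<le> t * norm x * norm v" .
  qed (use t in simp)
  then have "(norm g)\<^sup>2 \<le> (t * norm x)\<^sup>2" by (intro power_mono) auto
  also have "\<dots> \<le> t\<^sup>2 * t"
    using \<open>(norm x)\<^sup>2 \<le> t\<close> t by (simp add: power_mult_distrib)
  finally have "norm (g * g) \<le> t ^ 3"
    using norm_sa_square[OF sg] by (simp add: eval_nat_numeral)
  moreover have "norm ((2 * t) *\<^sub>R ((q * q) * (q * q))) \<le> norm (g * g)"
  proof (rule pos_mono_norm)
    show "pos ((2 * t) *\<^sub>R ((q * q) * (q * q)))"
      using q t by (intro pos_scaleR pos_square) auto
    \<comment> \<open>The two outer terms in the expansion of \<open>g * g\<close>; the middle one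
      is subtracted.\<close>
    have "pos ((t *\<^sub>R q) * (t *\<^sub>R q) + (q * (q * q)) * (q * (q * q)))"
      using q by (intro pos_add pos_square sa_mult) (auto simp: mult.assoc)
    also have "(t *\<^sub>R q) * (t *\<^sub>R q) + (q * (q * q)) * (q * (q * q))
        = g * g - (2 * t) *\<^sub>R ((q * q) * (q * q))"
      unfolding g2 by (simp add: algebra_simps scaleR_2 flip: scaleR_scaleR)
    finally show "pos (g * g - (2 * t) *\<^sub>R ((q * q) * (q * q)))" .
  qed
  moreover have "norm ((2 * t) *\<^sub>R ((q * q) * (q * q))) = 2 * t ^ 3"
    using q t by (simp add: norm_sa_square t_def eval_nat_numeral)
  moreover have "t ^ 3 > 0" using t by simp
  ultimately show False by linarith
qed

text \<open>With \<open>w\<close> the doubled negative part of \<open>x' * x\<close>, the product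
  belonging to \<open>x * w\<close> is minus a square, hence zero.\<close>

theorem pos_adj_mult:
  assumes x: "adj_pair x x'"
  shows "pos (x' * x)"
proof -
  obtain r w where rw: "sa w" "sa (r * w)" "w * (x' * x) * w = - ((r * w) * (r * w))"
    "r * w = 0 \<Longrightarrow> pos (x' * x)"
    using sa_adj_mult[OF x] by (rule negative_part) blast
  have "r * w = 0"
  proof (rule adj_square_negative)
    show "adj_pair (x * w) (w * x')"
      using adj_pair_mult[OF x] rw(1) by (simp add: sa_def)
    show "w * x' * (x * w) = - ((r * w) * (r * w))"
      using rw(3) by (simp add: mult.assoc)
  qed (rule rw(2))
  then show ?thesis by (rule rw(4))
qed

end

section \<open>The order on the algebra and the Cauchy--Schwarz inequality\<close>

interpretation self: cs_module "(*)" "\<lambda>a b. star a * b :: 'a::cstar_algebra"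
proof
  fix x y z :: 'a and c :: complex
  show "star x * x = 0 \<Longrightarrow> x = 0" using cstar_identity[of x] by simp
  show "norm (star x * y) \<le> norm x * norm y" using norm_mult_ineq[of "star x" y] by simp
qed (auto simp: algebra_simps scaleC_mult_left scaleC_mult_right star_mult star_star
    positive_element_def cstar_identity)

text \<open>The left regular representation; it embeds a possibly non-unital algebra into one with a
  unit.\<close>

definition lmul :: "'a::cstar_algebra \<Rightarrow> 'a bop" where
  "lmul a = op_of ((*) a)"

lemma app_lmul [simp]: "app (lmul a) b = a * b"
  by (simp add: lmul_def app_op_of bounded_linear_mult_right)

lemma lmul_simps:
  "lmul (a + b) = lmul a + lmul b" "lmul (a - b) = lmul a - lmul b"
  "lmul (- a) = - lmul a" "lmul (a * b) = lmul a * lmul b"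
  by (rule bop_eqI, simp add: algebra_simps)+

lemma adj_pair_lmul: "self.adj_pair (lmul a) (lmul (star a))"
  by (simp add: self.adj_pair_def star_mult mult.assoc)

text \<open>The lower bound comes from applying \<open>lmul a\<close> to \<open>star a\<close>, in
  place of a unit.\<close>

lemma norm_lmul: "norm (lmul a) = norm a"
proof (rule antisym)
  show "norm (lmul a) \<le> norm a"
    by (rule norm_bop_le) (simp_all add: norm_mult_ineq)
  show "norm a \<le> norm (lmul a)"
  proof (cases "a = 0")
    case False
    have "norm a * norm a = norm (app (lmul a) (star a))"
      using cstar_identity[of "star a"] by (simp add: star_star power2_eq_square)
    also have "\<dots> \<le> norm (lmul a) * norm a"
      using norm_app[of "lmul a" "star a"] by simp
    finally show ?thesis using False by simp
  qed simp
qed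

lemma pos_lmul: "positive_element a \<Longrightarrow> self.pos (lmul a)"
  unfolding positive_element_def using self.pos_adj_mult[OF adj_pair_lmul]
  by (auto simp: lmul_simps)

lemma positive_element_antisym:
  assumes "positive_element a" "positive_element (- a)"
  shows "a = 0"
proof -
  have "lmul a = 0"
    using assms[THEN pos_lmul] by (intro self.pos_antisym) (simp_all add: lmul_simps)
  then show ?thesis using norm_lmul[of a] by simp
qed

context hilbert_module
begin

lemma ip_act_left: "ip (act x a) y = star a * ip x y"
  by (metis ip_act_right ip_star star_mult)

text \<open>\<open>ip y y - star a * a\<close> is the sum of the square of
  \<open>act x a - y\<close> and of \<open>star a * (1 - ip x x) * a\<close>. The latter is positive
  because \<open>norm x \<le> 1\<close> gives \<open>1 - ip x x\<close> a root \<open>k\<close>;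
  then norms are monotone.\<close>

lemma norm_ip_le_of_norm_le_1:
  assumes "norm x \<le> 1"
  shows "norm (ip x y) \<le> norm y"
proof -
  define a where "a = ip x y"
  have star_a: "ip y x = star a" by (simp add: a_def ip_star)
  have x: "positive_element (ip x x)" by (rule ip_positive)
  have "norm (ip x x) \<le> 1"
    using assms by (simp add: power_le_one flip: norm_power2_ip)
  then have "self.pos (1 *\<^sub>R 1 - lmul (ip x x))"
    using self.pos_sa[OF pos_lmul[OF x]] by (intro self.pos_norm_minus) (auto simp: norm_lmul)
  then obtain k where k: "self.pos k" "k * k = 1 *\<^sub>R 1 - lmul (ip x x)"
    by (rule self.pos_sqrt) blast
  have "self.adj_pair k k" using self.pos_sa[OF k(1)] by (simp add: self.sa_def)
  then have "self.adj_pair (k * lmul a) (lmul (star a) * k)"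
    by (rule self.adj_pair_mult[OF _ adj_pair_lmul])
  then have "self.pos (lmul (star a) * k * (k * lmul a))"
    by (rule self.pos_adj_mult)
  also have "lmul (star a) * k * (k * lmul a) = lmul (star a) * (k * k) * lmul a"
    by (simp only: mult.assoc)
  also have "\<dots> = lmul (star a * a - star a * ip x x * a)"
    unfolding k(2) by (simp add: lmul_simps algebra_simps)
  finally have "self.pos (lmul (star a * a - star a * ip x x * a))" .
  moreover have "self.pos (lmul (ip (act x a - y) (act x a - y)))"
    by (intro pos_lmul ip_positive)
  ultimately have "self.pos (lmul (star a * a - star a * ip x x * a)
      + lmul (ip (act x a - y) (act x a - y)))"
    by (rule self.pos_add)
  also have "ip (act x a - y) (act x a - y) = star a * ip x x * a - star a * a - star a * a + ip y y"
    by (simp add: ip_simps ip_act_right ip_act_left star_a left_diff_distrib mult.assoc flip: a_def)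
  also have "lmul (star a * a - star a * ip x x * a)
      + lmul (star a * ip x x * a - star a * a - star a * a + ip y y) = lmul (ip y y) - lmul (star a * a)"
    by (simp add: lmul_simps)
  finally have "norm (lmul (star a * a)) \<le> norm (lmul (ip y y))"
    by (intro self.pos_mono_norm pos_lmul) (auto simp: positive_element_def)
  then have "(norm a)\<^sup>2 \<le> (norm y)\<^sup>2"
    by (simp add: norm_lmul cstar_identity norm_power2_ip)
  then show ?thesis by (simp add: a_def)
qed

lemma norm_ip_le: "norm (ip x y) \<le> norm x * norm y"
proof (cases "x = 0")
  case False
  have "norm (ip (x /\<^sub>R norm x) y) \<le> norm y"
    using False by (intro norm_ip_le_of_norm_le_1) simp
  then show ?thesis
    using False by (simp add: ip_scaleR_left field_simps)
qed simp

end

text \<open>From here on the order on operators is available in every Hilbert module.\<close>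

sublocale hilbert_module \<subseteq> cs_module act ip
  by unfold_locales (rule norm_ip_le)

section \<open>The absolute value of an adjointable operator\<close>

context hilbert_module
begin

text \<open>The Hellinger--Toeplitz theorem for Hilbert modules.\<close>

lemma bounded_linear_symmetric:
  assumes F: "\<And>x y. ip (F x) y = ip x (F y)"
  shows "bounded_linear F"
proof -
  have add: "F (x + y) = F x + F y" for x y
    by (rule ip_eqI_left) (simp add: ip_simps F)
  have scale: "F (r *\<^sub>R x) = r *\<^sub>R F x" for r x
    by (rule ip_eqI_left) (simp add: ip_simps F)
  define S where "S n = {x. \<forall>y. norm y \<le> 1 \<longrightarrow> norm (ip (F y) x) \<le> real n}" for n
  have "closed {x. norm (ip z x) \<le> c}" for z c
    by (intro closed_Collect_le continuous_on_norm linear_continuous_on bounded_linear_ip_right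
        continuous_on_const)
  then have clo: "closed (S n)" for n
    unfolding S_def by (intro closed_Collect_all closed_Collect_imp) auto
  \<comment> \<open>Symmetry moves \<open>F\<close> onto \<open>x\<close>, which bounds the family
    pointwise.\<close>
  have "x \<in> S (nat \<lceil>norm (F x)\<rceil>)" for x
  proof -
    have "norm (ip (F y) x) \<le> norm (F x)" if "norm y \<le> 1" for y
      unfolding F using norm_ip_le[of y "F x"] mult_left_le_one_le[of "norm (F x)" "norm y"] that
      by simp
    moreover have "norm (F x) \<le> real (nat \<lceil>norm (F x)\<rceil>)" by (rule real_nat_ceiling_ge)
    ultimately show ?thesis
      unfolding S_def using order_trans by blast
  qed
  then have cover: "\<Union>(range S) = UNIV" by blast
  have "\<exists>n. interior (S n) \<noteq> {}"
  proof (rule ccontr)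
    assume "\<nexists>n. interior (S n) \<noteq> {}"
    then have "euclidean interior_of \<Union>(range S) = {}"
      using clo by (intro Baire_category_alt)
        (auto simp: completely_metrizable_space_euclidean interior_of_def interior_def)
    then show False by (simp add: cover)
  qed
  then obtain n x0 where "x0 \<in> interior (S n)" by blast
  then obtain e where e: "e > 0" "ball x0 e \<subseteq> S n"
    unfolding mem_interior by blast
  have bd: "norm (F y) \<le> 4 * n / e" if y: "norm y \<le> 1" for y
  proof (cases "F y = 0")
    case False
    \<comment> \<open>A vector along \<open>F y\<close>, short enough for \<open>x0 + x\<close> to
      stay in the ball; it recovers the norm of \<open>F y\<close>.\<close>
    define x where "x = (e / 2 / norm (F y)) *\<^sub>R F y"
    have "norm x = e / 2" using False e by (simp add: x_def)
    then have "x0 + x \<in> ball x0 e" "x0 \<in> ball x0 e"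
      using e by (simp_all add: dist_norm)
    then have "x0 + x \<in> S n" "x0 \<in> S n" using e(2) by blast+
    then have "norm (ip (F y) (x0 + x)) \<le> n" "norm (ip (F y) x0) \<le> n"
      using y by (simp_all add: S_def)
    moreover have "ip (F y) x = ip (F y) (x0 + x) - ip (F y) x0"
      by (simp add: ip_simps)
    ultimately have "norm (ip (F y) x) \<le> 2 * n"
      using norm_triangle_ineq4[of "ip (F y) (x0 + x)" "ip (F y) x0"] by simp
    moreover have "norm (ip (F y) x) = e / 2 * norm (F y)"
      using False e by (simp add: x_def ip_scaleR_right power2_eq_square flip: norm_power2_ip)
    ultimately show ?thesis using e by (simp add: field_simps)
  qed (use e in simp)
  have "norm (F y) \<le> norm y * (4 * n / e)" for y
  proof (cases "y = 0")
    case True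
    then show ?thesis using scale[of 0 0] by simp
  next
    case False
    have "norm (F (y /\<^sub>R norm y)) \<le> 4 * n / e"
      using False by (intro bd) simp
    then show ?thesis using False by (simp add: scale field_simps)
  qed
  with add scale show ?thesis by (intro bounded_linear_intro)
qed

text \<open>At \<open>app w x\<close> the form equals minus an inner square, so properness of the
  cone in the algebra kills \<open>r * w\<close>.\<close>

lemma pos_of_positive_form:
  assumes F: "sa F" and form: "\<And>x. positive_element (ip x (app F x))"
  shows "pos F"
proof -
  obtain r w where rw: "sa w" "sa (r * w)" "w * F * w = - ((r * w) * (r * w))"
    "r * w = 0 \<Longrightarrow> pos F"
    using F by (rule negative_part) blast
  have "app (r * w) x = app 0 x" for x
  proof -
    let ?u = "app (r * w) x"
    have "ip (app w x) (app F (app w x)) = ip x (app (w * F * w) x)"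
      using rw(1) by (simp add: sa_ip)
    also have "\<dots> = - ip x (app (r * w) ?u)"
      unfolding rw(3) by (simp add: ip_simps)
    also have "\<dots> = - ip ?u ?u"
      by (simp only: sa_ip[OF rw(2)])
    finally have "positive_element (- ip ?u ?u)"
      using form[of "app w x"] by simp
    then have "ip ?u ?u = 0" by (intro positive_element_antisym ip_positive)
    then show ?thesis using ip_definite by simp
  qed
  then show ?thesis by (intro rw(4) bop_eqI)
qed

section \<open>Adjoints, positive operators and square roots as plain functions\<close>

lemma adj_eqI:
  assumes "\<And>x y. ipK (T x) y = ip x (S y)"
  shows "adj ip ipK T = S"
  unfolding adj_def
proof (rule the_equality)
  show "S' = S" if "\<forall>x y. ipK (T x) y = ip x (S' y)" for S'
    by (rule ext, rule ip_eqI) (use assms that in metis)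
qed (use assms in simp)

lemma ip_adj:
  assumes "T \<in> adjointable ip ipK"
  shows "ipK (T x) y = ip x (adj ip ipK T y)"
proof -
  obtain S where S: "\<And>x y. ipK (T x) y = ip x (S y)"
    using assms by (auto simp: adjointable_def)
  then have "adj ip ipK T = S" by (rule adj_eqI)
  with S show ?thesis by simp
qed

lemma ip_adj_comp:
  assumes K: "hilbert_module actK ipK" and T: "T \<in> adjointable ip ipK"
  shows "ip ((adj ip ipK T \<circ> T) x) y = ipK (T x) (T y)"
    "ip x ((adj ip ipK T \<circ> T) y) = ipK (T x) (T y)"
proof -
  show *: "ip x ((adj ip ipK T \<circ> T) y) = ipK (T x) (T y)" for x y
    using ip_adj[OF T] by simp
  show "ip ((adj ip ipK T \<circ> T) x) y = ipK (T x) (T y)"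
    using * hilbert_module.ip_star[OF K] ip_star by metis
qed

text \<open>\<open>T\<close> may map into another module, so \<open>pos_adj_mult\<close> is out of
  reach; positivity is read off the form \<open>ipK (T x) (T x)\<close>.\<close>

lemma adj_comp_pos:
  assumes K: "hilbert_module actK ipK" and T: "T \<in> adjointable ip ipK"
  obtains h where "pos h" "app h = adj ip ipK T \<circ> T"
proof -
  let ?F = "adj ip ipK T \<circ> T"
  have "bounded_linear ?F"
    by (rule bounded_linear_symmetric) (simp only: ip_adj_comp[OF K T])
  then have F: "app (op_of ?F) = ?F" by (rule app_op_of)
  moreover have "pos (op_of ?F)"
  proof (rule pos_of_positive_form)
    show "sa (op_of ?F)"
      by (rule saI) (simp only: F ip_adj_comp[OF K T])
    show "positive_element (ip x (app (op_of ?F) x))" for x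
      unfolding F ip_adj_comp[OF K T] by (rule hilbert_module.ip_positive[OF K])
  qed
  ultimately show thesis using that by blast
qed

lemma positive_operator_iff: "positive_operator ip S \<longleftrightarrow> (\<exists>k. pos k \<and> S = app k)"
proof
  assume "positive_operator ip S"
  then obtain R where "R \<in> adjointable ip ip" "S = adj ip ip R \<circ> R"
    by (auto simp: positive_operator_def)
  then show "\<exists>k. pos k \<and> S = app k"
    using adj_comp_pos[OF hilbert_module_axioms, of R] by metis
next
  assume "\<exists>k. pos k \<and> S = app k"
  then obtain k where k: "pos k" "S = app k" by blast
  obtain r where r: "pos r" "r * r = k"
    using k(1) by (rule pos_sqrt) blast
  have "adj ip ip (app r) = app r"
    by (rule adj_eqI) (rule sa_ip[OF pos_sa[OF r(1)]])
  moreover have "app r \<in> adjointable ip ip"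
    using sa_ip[OF pos_sa[OF r(1)]] by (auto simp: adjointable_def)
  ultimately show "positive_operator ip S"
    unfolding positive_operator_def using k(2) r(2) by (intro bexI[of _ "app r"]) auto
qed

lemma sqrt_operator_app:
  assumes "pos k"
  shows "sqrt_operator ip (app k \<circ> app k) = app k"
  unfolding sqrt_operator_def
proof (rule the_equality)
  show "positive_operator ip (app k) \<and> app k \<circ> app k = app k \<circ> app k"
    using assms positive_operator_iff by auto
  fix S assume "positive_operator ip S \<and> S \<circ> S = app k \<circ> app k"
  then obtain l where l: "pos l" "S = app l" "app l \<circ> app l = app k \<circ> app k"
    using positive_operator_iff by auto
  then have "l * l = k * k"
    by (intro bop_eqI) (simp add: fun_eq_iff)
  then show "S = app k"
    using pos_sqrt_unique[OF l(1) assms] l(2) by simp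
qed

lemma abs_operator_props:
  assumes "hilbert_module actK ipK" and "T \<in> adjointable ip ipK"
  defines "A \<equiv> abs_operator ip ipK T"
  shows "ip (A x) y = ip x (A y)" "A \<circ> A = adj ip ipK T \<circ> T"
proof -
  obtain h where h: "pos h" "app h = adj ip ipK T \<circ> T"
    using assms(1,2) by (rule adj_comp_pos)
  obtain k where k: "pos k" "k * k = h"
    using h(1) by (rule pos_sqrt) blast
  have sq: "app k \<circ> app k = adj ip ipK T \<circ> T"
    using k(2) h(2) by (auto simp: fun_eq_iff)
  then have "A = app k"
    unfolding A_def abs_operator_def using sqrt_operator_app[OF k(1)] by simp
  then show "ip (A x) y = ip x (A y)" "A \<circ> A = adj ip ipK T \<circ> T"
    using sa_ip[OF pos_sa[OF k(1)]] sq by simp_all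
qed

end

section \<open>Polar decomposition\<close>

theorem theorem3p13:
  fixes actH :: "'h::complex_banach \<Rightarrow> 'a::cstar_algebra \<Rightarrow> 'h"
    and ipH :: "'h \<Rightarrow> 'h \<Rightarrow> 'a"
    and actK :: "'k::complex_banach \<Rightarrow> 'a \<Rightarrow> 'k"
    and ipK :: "'k \<Rightarrow> 'k \<Rightarrow> 'a"
    and T U :: "'h \<Rightarrow> 'k"
  assumes "hilbert_module actH ipH"
    and "hilbert_module actK ipK"
    and "T \<in> adjointable ipH ipK"
    and "orthogonally_complemented ipH (closure (range (adj ipH ipK T)))"
    and "U \<in> adjointable ipH ipK"
    and "partial_isometry ipH ipK U"
    and "T = U \<circ> abs_operator ipH ipK T"
    and "null_space T \<subseteq> null_space U"
  shows "is_polar_decomposition ipH ipK T U"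
proof -
  interpret H: hilbert_module actH ipH by fact
  interpret K: hilbert_module actK ipK by fact
  note T = assms(3) and U = assms(5) and null = assms(8)
  define A where "A = abs_operator ipH ipK T"
  define Ts where "Ts = adj ipH ipK T"
  define Us where "Us = adj ipH ipK U"
  define Q where "Q = Us \<circ> U"
  define M where "M = closure (range Ts)"
  have A: "ipH (A x) y = ipH x (A y)" "A \<circ> A = Ts \<circ> T" for x y
    unfolding A_def Ts_def by (rule H.abs_operator_props[OF assms(2) T])+
  have TUA: "T x = U (A x)" for x
    using fun_cong[OF assms(7)] by (simp add: A_def)
  have Ts: "ipK (T x) y = ipH x (Ts y)" for x y
    unfolding Ts_def by (rule H.ip_adj[OF T])
  have Us: "ipK (U x) y = ipH x (Us y)" for x y
    unfolding Us_def by (rule H.ip_adj[OF U])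
  have Q: "ipH (Q x) y = ipH x (Q y)" "ipH x (Q y) = ipK (U x) (U y)" for x y
    unfolding Q_def Us_def by (simp_all only: H.ip_adj_comp[OF assms(2) U])
  have QQ: "Q (Q x) = Q x" for x
    using assms(6) by (simp add: partial_isometry_def projection_def fun_eq_iff Q_def Us_def)
  have linQ: "bounded_linear Q"
    using Q(1) by (rule H.bounded_linear_symmetric)

  have QA: "Q (A x) = A x" for x
  proof -
    \<comment> \<open>Both terms on the right equal \<open>ipK (T x) (T x)\<close>: one by
      \<open>A \<circ> A = Ts \<circ> T\<close>, the other by
      \<open>T = U \<circ> A\<close>.\<close>
    have "ipH (A x - Q (A x)) (A x - Q (A x)) = ipH (A x) (A x) - ipH (A x) (Q (A x))"
      by (simp add: H.ip_simps Q(1) QQ)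
    also have "ipH (A x) (A x) = ipH (A x) (Q (A x))"
      using fun_cong[OF A(2), of x] by (simp add: A(1) Q(2) Ts flip: TUA)
    finally show ?thesis using H.ip_definite[of "A x - Q (A x)"] by simp
  qed
  \<comment> \<open>The adjoint of \<open>T = U \<circ> A\<close>, with \<open>A\<close>
    symmetric.\<close>
  have "Ts y = A (Us y)" for y
    by (rule H.ip_eqI) (simp add: TUA A(1) Us flip: Ts)
  then have "range Ts \<subseteq> {x. Q x = x}" using QA by auto
  moreover have "closed {x. Q x = x}"
    by (intro closed_Collect_eq linear_continuous_on linQ continuous_on_id)
  ultimately have QM: "Q m = m" if "m \<in> M" for m
    using closure_minimal[of "range Ts" "{x. Q x = x}"] that unfolding M_def by auto
  have QM': "Q n = 0" if "n \<in> orth_compl ipH M" for n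
  proof -
    \<comment> \<open>Orthogonality of \<open>n\<close> to this vector gives \<open>T n = 0\<close>,
      and the null space inclusion then gives \<open>U n = 0\<close>.\<close>
    have "Ts (T n) \<in> M" unfolding M_def by (rule subsetD[OF closure_subset]) simp
    then have "ipK (T n) (T n) = 0" using that by (simp add: Ts orth_compl_def)
    then have "U n = 0" using K.ip_definite null by (auto simp: null_space_def)
    then show ?thesis
      by (intro H.ip_eqI) (simp add: Q(2))
  qed
  have "Q x = proj_onto ipH M x" for x
  proof -
    have "x \<in> {m + n | m n. m \<in> M \<and> n \<in> orth_compl ipH M}"
      using assms(4) unfolding orthogonally_complemented_def M_def Ts_def by blast
    then obtain m n where mn: "x = m + n" "m \<in> M" "n \<in> orth_compl ipH M" by blast
    \<comment> \<open>Every decomposition of \<open>x\<close> has first summand \<open>Q x\<close>,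
      which settles the uniqueness behind \<open>proj_onto\<close>.\<close>
    have eq: "Q x = m'" if "m' \<in> M" "x - m' \<in> orth_compl ipH M" for m'
      using QM[OF that(1)] QM'[OF that(2)] linear_diff[OF bounded_linear.linear[OF linQ]] by simp
    have Qx: "Q x = m" using eq[of m] mn by simp
    show ?thesis
      unfolding proj_onto_def
    proof (rule the_equality[symmetric])
      show "Q x \<in> M \<and> x - Q x \<in> orth_compl ipH M" unfolding Qx using mn by simp
      show "m' = Q x" if "m' \<in> M \<and> x - m' \<in> orth_compl ipH M" for m'
        using eq[of m'] that by simp
    qed
  qed
  then have "Us \<circ> U = proj_onto ipH M" by (auto simp: Q_def)
  then show ?thesis
    unfolding is_polar_decomposition_def
    using assms(4,6,7) by (simp add: Us_def M_def Ts_def)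
qed

end
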